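(* Let $n$ and $k$ be positive integers with $k>\lceil 2n/3\rceil$. Let $\mathcal{G}_{n,k}$ denote the set of connected simple graphs of order $n$ with dissociation number $k$. If $G\in\mathcal{G}_{n,k}$ satisfies $\rho(G)\le\rho(H)$ for every $H\in\mathcal{G}_{n,k}$, then $G$ is a tree.
   Context: All graphs are finite and simple. A set $S$ of vertices of a graph $G$ is a dissociation set if the induced subgraph $G[S]$ has maximum degree at most $1$; the dissociation number $diss(G)$ is the maximum cardinality of a dissociation set of $G$. The spectral radius $\rho(G)$ is the largest eigenvalue of the adjacency matrix of $G$. *)

theory Defs
  imports
    "Jordan_Normal_Form.Spectral_Radius"
    "Graph_Theory.Graph_Theory"
begin

text \<open>
  A finite simple graph is a \<^locale>\<open>pair_graph\<close>: a finite, loop-free, symmetric set of arcs,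
  each edge \<open>uv\<close> being represented by the two arcs \<open>(u,v)\<close> and \<open>(v,u)\<close>.  Hence the degree of a
  vertex is its \<^const>\<open>out_degree\<close>.
\<close>

definition dissociation_set :: "'a pair_pre_digraph \<Rightarrow> 'a set \<Rightarrow> bool" where
  "dissociation_set G S \<longleftrightarrow>
     S \<subseteq> pverts G \<and> (\<forall>v\<in>S. out_degree (with_proj G \<restriction> S) v \<le> 1)"

definition diss :: "'a pair_pre_digraph \<Rightarrow> nat" where
  "diss G = Max {card S | S. dissociation_set G S}"

definition adjacency_matrix :: "'a pair_pre_digraph \<Rightarrow> 'a list \<Rightarrow> real mat" where
  "adjacency_matrix G vs =
     mat (length vs) (length vs) (\<lambda>(i, j). if (vs ! i, vs ! j) \<in> parcs G then 1 else 0)"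

text \<open>
  Changing the enumeration of the vertices conjugates the adjacency matrix by a permutation
  matrix, so the choice of \<open>vs\<close> is immaterial.  For a graph the matrix is real symmetric, so its
  eigenvalues are exactly its real ones; \<^const>\<open>Spectral_Radius.spectral_radius\<close>, which is
  about the moduli of the eigenvalues of a complex matrix, is not used.
\<close>

definition rho :: "'a pair_pre_digraph \<Rightarrow> real" where
  "rho G = Max (spectrum (adjacency_matrix G (SOME vs. distinct vs \<and> set vs = pverts G)))"

text \<open>
  \<^const>\<open>Digraph_Component.tree\<close> is not usable for symmetric digraphs, since there the closed walk
  \<open>u, v, u\<close> along a single edge counts as a cycle.  In a \<^locale>\<open>pair_graph\<close> the cycles of the
  undirected graph are the directed cycles of length at least 3.
\<close>

definition is_tree :: "'a pair_pre_digraph \<Rightarrow> bool" where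
  "is_tree G \<longleftrightarrow>
     pair_graph G \<and> Digraph_Component.connected (with_proj G) \<and>
     \<not> (\<exists>p. pre_digraph.cycle (with_proj G) p \<and> length p \<ge> 3)"

definition graphs_with_diss :: "nat \<Rightarrow> nat \<Rightarrow> 'a pair_pre_digraph set" where
  "graphs_with_diss n k =
     {G. pair_graph G \<and> Digraph_Component.connected (with_proj G) \<and>
         card (pverts G) = n \<and> diss G = k}"

end

theory Submission
  imports Defs "HOL-Analysis.Function_Topology"
begin

text \<open>
  If the minimiser \<open>G\<close> is not a tree, pass to a spanning tree \<open>T\<close>: the spectral radius drops
  strictly, but the dissociation number may grow beyond \<open>k\<close>.  It is brought back to \<open>k\<close> without
  increasing the radius by rehanging steps.  At a branching vertex \<open>v\<close> with two pendant paths, the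
  second path is cut off from \<open>v\<close> and reattached to the far end of the first one.  Each step loses
  one leaf and changes the dissociation number by at most one; by an explicit supersolution of the
  eigenvalue equation it does not increase the radius as long as the radius is at least 2, which
  holds for trees with at least four leaves.  Counting edges between a maximum dissociation set and
  its complement gives \<open>3 diss T + 2 \<le> 2 n + 2 L\<close> for a tree with \<open>L\<close> leaves, so for
  \<open>k > \<lceil>2 n / 3\<rceil>\<close> there are at least four leaves as long as \<open>diss T > k\<close>.
\<close>

section \<open>Perron vectors of adjacency matrices\<close>

locale sgraph =
  fixes V :: "'a set" and E :: "'a rel"
  assumes finite_V: "finite V" and E_subset: "E \<subseteq> V \<times> V" and sym_E: "sym E" and irrefl_E: "irrefl E"

text \<open>The adjacency operator applied to \<open>x\<close> and evaluated at \<open>u\<close>.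
  Functions on the vertices replace vectors, so that several arc relations on one vertex set can be
  compared without an enumeration.\<close>

abbreviation nbsum :: "'a rel \<Rightarrow> ('a \<Rightarrow> real) \<Rightarrow> 'a \<Rightarrow> real" where
  "nbsum E x u \<equiv> \<Sum>v\<in>E `` {u}. x v"

abbreviation radius :: "'a set \<Rightarrow> 'a rel \<Rightarrow> real" where
  "radius V E \<equiv> rho \<lparr>pverts = V, parcs = E\<rparr>"

text \<open>An enumeration turns vectors into functions on the vertices, and the eigenvector
  equation becomes one about neighbour sums that no longer depends on the order of the
  vertices.\<close>

lemma mem_spectrum_adjacency_matrix_iff:
  assumes "distinct vs" and E: "E \<subseteq> set vs \<times> set vs"
  shows "\<mu> \<in> spectrum (adjacency_matrix \<lparr>pverts = V, parcs = E\<rparr> vs) \<longleftrightarrow>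
    (\<exists>y. (\<exists>v\<in>set vs. y v \<noteq> 0) \<and> (\<forall>u\<in>set vs. nbsum E y u = \<mu> * y u))"
    (is "?L \<longleftrightarrow> ?R")
proof -
  let ?A = "adjacency_matrix \<lparr>pverts = V, parcs = E\<rparr> vs"
  let ?n = "length vs"
  have dim: "dim_row ?A = ?n" "?A \<in> carrier_mat ?n ?n"
    by (auto simp: adjacency_matrix_def)
  have bij: "bij_betw ((!) vs) {..<?n} (set vs)"
    using assms(1) by (intro bij_betw_nth) auto
  have row: "(?A *\<^sub>v v) $ i = nbsum E y (vs ! i)"
    if "i < ?n" "v \<in> carrier_vec ?n" and y: "\<And>j. j < ?n \<Longrightarrow> v $ j = y (vs ! j)" for v y i
  proof -
    have "(?A *\<^sub>v v) $ i = (\<Sum>j<?n. (if (vs ! i, vs ! j) \<in> E then y (vs ! j) else 0))"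
      using that by (auto simp: adjacency_matrix_def scalar_prod_def atLeast0LessThan intro!: sum.cong)
    also have "\<dots> = (\<Sum>w\<in>set vs. (if (vs ! i, w) \<in> E then y w else 0))"
      by (rule sum.reindex_bij_betw[OF bij])
    also have "\<dots> = (\<Sum>w\<in>set vs \<inter> {w. (vs ! i, w) \<in> E}. y w)"
      by (simp add: sum.inter_restrict)
    also have "set vs \<inter> {w. (vs ! i, w) \<in> E} = E `` {vs ! i}"
      using E by auto
    finally show ?thesis .
  qed
  show ?thesis
  proof
    assume ?L
    then obtain v where v: "v \<in> carrier_vec ?n" "v \<noteq> 0\<^sub>v ?n" "?A *\<^sub>v v = \<mu> \<cdot>\<^sub>v v"
      by (auto simp: spectrum_def eigenvalue_def eigenvector_def dim)
    define y where "y u = v $ (inv_into {..<?n} ((!) vs) u)" for u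
    have y: "v $ j = y (vs ! j)" if "j < ?n" for j
      using that bij by (simp add: y_def bij_betw_def)
    have "\<exists>j<?n. v $ j \<noteq> 0"
      using v by (metis carrier_vecD eq_vecI index_zero_vec(1,2))
    then have "\<exists>u\<in>set vs. y u \<noteq> 0"
      using y by (metis nth_mem)
    moreover have "nbsum E y u = \<mu> * y u" if u: "u \<in> set vs" for u
    proof -
      obtain i where i: "i < ?n" "u = vs ! i" using u by (metis in_set_conv_nth)
      have "nbsum E y (vs ! i) = (?A *\<^sub>v v) $ i"
        by (rule row[OF i(1) v(1), symmetric]) (rule y)
      also have "\<dots> = \<mu> * v $ i" unfolding v(3) using i(1) v(1) by simp
      finally show ?thesis unfolding i(2) y[OF i(1)] .
    qed
    ultimately show ?R by blast
  next
    assume ?R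
    then obtain y where y: "\<exists>v\<in>set vs. y v \<noteq> 0" "\<forall>u\<in>set vs. nbsum E y u = \<mu> * y u" by blast
    define v where "v = vec ?n (\<lambda>i. y (vs ! i))"
    have v: "v \<in> carrier_vec ?n" "\<And>j. j < ?n \<Longrightarrow> v $ j = y (vs ! j)" by (auto simp: v_def)
    have "v \<noteq> 0\<^sub>v ?n"
      using y(1) v(2) by (metis in_set_conv_nth index_zero_vec(1))
    moreover have "?A *\<^sub>v v = \<mu> \<cdot>\<^sub>v v"
    proof (rule eq_vecI)
      fix i assume "i < dim_vec (\<mu> \<cdot>\<^sub>v v)"
      then have i: "i < ?n" using v(1) by simp
      have "(?A *\<^sub>v v) $ i = nbsum E y (vs ! i)"
        by (rule row[OF i v(1)]) (rule v(2))
      then show "(?A *\<^sub>v v) $ i = (\<mu> \<cdot>\<^sub>v v) $ i"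
        using y(2) i by (simp add: v_def)
    qed (use v(1) dim in simp)
    ultimately show ?L
      using v(1) by (auto simp: spectrum_def eigenvalue_def eigenvector_def dim)
  qed
qed

context sgraph
begin

lemma symD: "(u, v) \<in> E \<Longrightarrow> (v, u) \<in> E"
  using sym_E by (rule symD)

lemma nbsum_eq: "nbsum E x u = (\<Sum>v\<in>V. if (u, v) \<in> E then x v else 0)"
proof -
  have "E `` {u} = V \<inter> {v. (u, v) \<in> E}" using E_subset by auto
  then show ?thesis by (simp add: sum.inter_restrict finite_V)
qed

text \<open>Self-adjointness of the adjacency operator: swap the two summations and use the symmetry
  of \<open>E\<close>.\<close>

lemma nbsum_sym: "(\<Sum>u\<in>V. x u * nbsum E y u) = (\<Sum>u\<in>V. y u * nbsum E x u)"
proof -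
  have "(\<Sum>u\<in>V. x u * nbsum E y u) = (\<Sum>u\<in>V. \<Sum>v\<in>V. if (u, v) \<in> E then x u * y v else 0)"
    unfolding nbsum_eq sum_distrib_left by (intro sum.cong) auto
  also have "\<dots> = (\<Sum>v\<in>V. \<Sum>u\<in>V. if (v, u) \<in> E then y v * x u else 0)"
    by (subst sum.swap) (intro sum.cong, auto dest: symD)
  finally show ?thesis
    unfolding nbsum_eq sum_distrib_left by (auto intro!: sum.cong)
qed

lemma nbsum_lin: "nbsum E (\<lambda>v. x v + t * y v) u = nbsum E x u + t * nbsum E y u"
  by (simp add: sum.distrib sum_distrib_left)

text \<open>Compactness gives a maximiser among the unit vectors with nonnegative entries. It bounds
  the form everywhere, because replacing the entries of \<open>y\<close> by their absolute values
  keeps the norm and does not decrease the form.\<close>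

lemma quadratic_form_maximizer:
  assumes "V \<noteq> {}"
  obtains M x where "\<And>v. (0::real) \<le> x v" "(\<Sum>v\<in>V. (x v)\<^sup>2) = 1" "(\<Sum>u\<in>V. x u * nbsum E x u) = M"
    "\<And>y. (\<Sum>u\<in>V. y u * nbsum E y u) \<le> M * (\<Sum>v\<in>V. (y v)\<^sup>2)"
proof -
  define Q where "Q y = (\<Sum>u\<in>V. y u * nbsum E y u)" for y
  define S where "S = {x :: 'a \<Rightarrow> real. (\<Sum>v\<in>V. (x v)\<^sup>2) = 1}"
  \<comment> \<open>The cube has a coordinate for every element of the type, possibly infinitely
    many; it is compact by Tychonoff's theorem, while the norm in \<open>S\<close> involves only the
    coordinates in \<open>V\<close>.\<close>
  define K where "K = (\<Pi>\<^sub>E i\<in>UNIV. {0..1::real}) \<inter> S"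
  have coord: "continuous_on A (\<lambda>x::'a \<Rightarrow> real. x i)" for A i
    by (rule continuous_on_subset[OF continuous_on_product_coordinates subset_UNIV])
  have "compactin (product_topology (\<lambda>i::'a. euclidean) UNIV) (\<Pi>\<^sub>E i\<in>UNIV. {0..1::real})"
    by (simp add: compactin_PiE)
  then have "compact (\<Pi>\<^sub>E i\<in>(UNIV::'a set). {0..1::real})"
    by (simp add: euclidean_product_topology)
  moreover have "closed S"
    unfolding S_def by (intro closed_Collect_eq continuous_intros coord)
  ultimately have "compact K" by (simp add: K_def compact_Int_closed)
  obtain v0 where v0: "v0 \<in> V" using assms by blast
  have "(\<Sum>v\<in>V. (of_bool (v = v0) :: real)\<^sup>2) = (\<Sum>v\<in>V. if v = v0 then 1 else 0)"
    by (intro sum.cong) auto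
  also have "\<dots> = 1" using v0 finite_V by simp
  finally have "(\<lambda>v. of_bool (v = v0)) \<in> K" by (auto simp: K_def S_def)
  then have "K \<noteq> {}" by blast
  moreover have "continuous_on K Q"
    unfolding Q_def by (intro continuous_intros coord)
  ultimately obtain x where x: "x \<in> K" and max: "\<And>y. y \<in> K \<Longrightarrow> Q y \<le> Q x"
    using continuous_attains_sup[OF \<open>compact K\<close>] by blast
  have "Q y \<le> Q x * (\<Sum>v\<in>V. (y v)\<^sup>2)" for y
  proof (cases "(\<Sum>v\<in>V. (y v)\<^sup>2) = 0")
    case True
    then have "\<forall>v\<in>V. y v = 0" using finite_V by (simp add: sum_nonneg_eq_0_iff)
    then show ?thesis using True by (simp add: Q_def)
  next
    case False
    define n where "n = (\<Sum>v\<in>V. (y v)\<^sup>2)"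
    have n: "n > 0" using False by (simp add: n_def sum_nonneg less_le)
    \<comment> \<open>The entries outside \<open>V\<close> become 0 so that \<open>z\<close> lies in
      the cube; neither the form nor the norm sees them.\<close>
    define z where "z v = (if v \<in> V then \<bar>y v\<bar> / sqrt n else 0)" for v
    have "(\<Sum>v\<in>V. (z v)\<^sup>2) = (\<Sum>v\<in>V. (y v)\<^sup>2 / n)"
      using n by (intro sum.cong) (auto simp: z_def power_divide)
    also have "\<dots> = 1" using n by (simp add: n_def flip: sum_divide_distrib)
    finally have zS: "z \<in> S" by (simp add: S_def)
    have "\<bar>y v\<bar> \<le> sqrt n" if "v \<in> V" for v
      unfolding n_def using that finite_V
      by (intro real_le_rsqrt) (simp, rule member_le_sum[of v V "\<lambda>v. (y v)\<^sup>2"], auto)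
    then have "z \<in> K" using n zS by (auto simp: K_def z_def)
    have "Q y \<le> (\<Sum>u\<in>V. \<bar>y u\<bar> * nbsum E (\<lambda>v. \<bar>y v\<bar>) u)"
      unfolding Q_def
    proof (intro sum_mono)
      fix u
      have "y u * nbsum E y u \<le> \<bar>y u\<bar> * \<bar>nbsum E y u\<bar>"
        unfolding abs_mult[symmetric] by (rule abs_ge_self)
      also have "\<dots> \<le> \<bar>y u\<bar> * nbsum E (\<lambda>v. \<bar>y v\<bar>) u"
        by (intro mult_left_mono sum_abs) auto
      finally show "y u * nbsum E y u \<le> \<bar>y u\<bar> * nbsum E (\<lambda>v. \<bar>y v\<bar>) u" .
    qed
    also have "\<dots> = (\<Sum>u\<in>V. n * (z u * nbsum E z u))"
    proof (intro sum.cong refl)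
      fix u assume u: "u \<in> V"
      have "nbsum E (\<lambda>v. \<bar>y v\<bar>) u = nbsum E (\<lambda>v. sqrt n * z v) u"
        using n E_subset by (intro sum.cong) (auto simp: z_def)
      then have "nbsum E (\<lambda>v. \<bar>y v\<bar>) u = sqrt n * nbsum E z u"
        by (simp add: sum_distrib_left)
      moreover have "\<bar>y u\<bar> = sqrt n * z u" using n u by (simp add: z_def)
      ultimately show "\<bar>y u\<bar> * nbsum E (\<lambda>v. \<bar>y v\<bar>) u = n * (z u * nbsum E z u)"
        using n by (simp add: algebra_simps)
    qed
    also have "\<dots> = n * Q z" by (simp add: Q_def sum_distrib_left)
    also have "\<dots> \<le> n * Q x" using max[OF \<open>z \<in> K\<close>] n by simp
    finally show ?thesis by (simp add: n_def mult.commute)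
  qed
  then have "\<And>y. (\<Sum>u\<in>V. y u * nbsum E y u) \<le> (\<Sum>u\<in>V. x u * nbsum E x u) * (\<Sum>v\<in>V. (y v)\<^sup>2)"
    unfolding Q_def .
  moreover have "\<And>v. 0 \<le> x v" "(\<Sum>v\<in>V. (x v)\<^sup>2) = 1" using x by (auto simp: K_def S_def)
  ultimately show thesis by (intro that[OF _ _ refl])
qed

text \<open>The first-order condition at a maximiser of the quadratic form is the eigenvalue
  equation for the maximum \<open>M\<close>. Inserting any eigenvector into the form shows that its
  eigenvalue is at most \<open>M\<close>, so \<open>M\<close> is the radius.\<close>

lemma perron_nonneg:
  assumes "V \<noteq> {}"
  obtains x where "\<And>v. 0 \<le> x v" "\<exists>v\<in>V. x v \<noteq> 0" "\<And>u. u \<in> V \<Longrightarrow> nbsum E x u = radius V E * x u"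
    "\<And>y. (\<Sum>u\<in>V. y u * nbsum E y u) \<le> radius V E * (\<Sum>v\<in>V. (y v)\<^sup>2)"
proof -
  obtain M x where x: "\<And>v. 0 \<le> x v" "(\<Sum>v\<in>V. (x v)\<^sup>2) = 1" "(\<Sum>u\<in>V. x u * nbsum E x u) = M"
    and Q: "\<And>y. (\<Sum>u\<in>V. y u * nbsum E y u) \<le> M * (\<Sum>v\<in>V. (y v)\<^sup>2)"
    by (rule quadratic_form_maximizer[OF assms]) blast
  have M: "M \<ge> 0" using x by (auto intro!: sum_nonneg mult_nonneg_nonneg)
  have eig: "nbsum E x u = M * x u" if u: "u \<in> V" for u
  proof -
    define d :: "'a \<Rightarrow> real" where "d v = of_bool (v = u)" for v
    define D where "D = nbsum E x u - M * x u"
    have d_sum: "(\<Sum>v\<in>V. d v * f v) = f u" for f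
      using u finite_V by (simp add: d_def of_bool_def if_distrib[of "\<lambda>c. c * _"] cong: if_cong)
    have "nbsum E d u = 0"
      using irrefl_E by (auto simp: d_def irrefl_def intro!: sum.neutral)
    \<comment> \<open>Compare the form at \<open>x + t d\<close> with its upper bound. As
      \<open>u\<close> has no loop, the form has no term quadratic in \<open>t\<close>; only the
      norm contributes one.\<close>
    have lin: "2 * t * D \<le> t\<^sup>2 * M" for t
    proof -
      have xd: "(\<Sum>v\<in>V. x v * nbsum E d v) = nbsum E x u" using nbsum_sym d_sum by metis
      have "(\<Sum>v\<in>V. (x v + t * d v) * nbsum E (\<lambda>v. x v + t * d v) v)
          = (\<Sum>v\<in>V. x v * nbsum E x v + t * (x v * nbsum E d v) + t * (d v * nbsum E x v)
              + t\<^sup>2 * (d v * nbsum E d v))"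
        unfolding nbsum_lin by (intro sum.cong) (auto simp: algebra_simps power2_eq_square)
      also have "\<dots> = M + 2 * t * nbsum E x u"
        by (simp add: sum.distrib xd d_sum x \<open>nbsum E d u = 0\<close> flip: sum_distrib_left)
      finally have 1: "(\<Sum>v\<in>V. (x v + t * d v) * nbsum E (\<lambda>v. x v + t * d v) v) = M + 2 * t * nbsum E x u" .
      have "(\<Sum>v\<in>V. (x v + t * d v)\<^sup>2) = (\<Sum>v\<in>V. (x v)\<^sup>2 + 2 * t * (d v * x v) + t\<^sup>2 * (d v * d v))"
        by (intro sum.cong) (auto simp: algebra_simps power2_eq_square)
      also have "\<dots> = 1 + 2 * t * x u + t\<^sup>2"
        by (simp add: sum.distrib d_sum x flip: sum_distrib_left) (simp add: d_def)
      finally have 2: "(\<Sum>v\<in>V. (x v + t * d v)\<^sup>2) = 1 + 2 * t * x u + t\<^sup>2" .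
      show ?thesis using Q[of "\<lambda>v. x v + t * d v"] unfolding 1 2 D_def by (simp add: algebra_simps)
    qed
    have "D = 0"
    proof (rule ccontr)
      assume "D \<noteq> 0"
      \<comment> \<open>For this nonzero \<open>t\<close>, \<open>lin\<close> says that
        \<open>2 * (M + 1)\<close> is at most \<open>M\<close>, which is impossible as
        \<open>M\<close> is nonnegative.\<close>
      define t where "t = D / (M + 1)"
      have D: "D = t * (M + 1)" using M by (simp add: t_def)
      have "t\<^sup>2 > 0" using D \<open>D \<noteq> 0\<close> by auto
      moreover have "t\<^sup>2 * (2 * (M + 1)) \<le> t\<^sup>2 * M"
        using lin[of t] unfolding D by (simp add: algebra_simps power2_eq_square)
      ultimately show False using M by simp
    qed
    then show ?thesis by (simp add: D_def)
  qed
  have nz: "\<exists>v\<in>V. x v \<noteq> 0" using x(2) by (rule contrapos_pp) auto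
  \<comment> \<open>The enumeration that \<open>rho\<close> itself selects.\<close>
  define vs where "vs = (SOME vs. distinct vs \<and> set vs = V)"
  have vs: "distinct vs" "set vs = V"
    using someI_ex[of "\<lambda>vs. distinct vs \<and> set vs = V"] finite_distinct_list[OF finite_V]
    unfolding vs_def by blast+
  let ?S = "spectrum (adjacency_matrix \<lparr>pverts = V, parcs = E\<rparr> vs)"
  have S: "\<mu> \<in> ?S \<longleftrightarrow> (\<exists>y. (\<exists>v\<in>V. y v \<noteq> 0) \<and> (\<forall>u\<in>V. nbsum E y u = \<mu> * y u))" for \<mu>
    using mem_spectrum_adjacency_matrix_iff[OF vs(1)] E_subset vs(2) by blast
  have "Max ?S = M"
  proof (rule Max_eqI)
    show "finite ?S"
      by (rule card_finite_spectrum[of _ "length vs"]) (simp add: adjacency_matrix_def)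
    show "M \<in> ?S" using S eig nz by blast
    fix \<mu> assume "\<mu> \<in> ?S"
    then obtain y where y: "\<exists>v\<in>V. y v \<noteq> 0" "\<forall>u\<in>V. nbsum E y u = \<mu> * y u" using S by blast
    have "(\<Sum>u\<in>V. y u * nbsum E y u) = (\<Sum>u\<in>V. \<mu> * (y u)\<^sup>2)"
      using y(2) by (intro sum.cong) (auto simp: power2_eq_square)
    then have "\<mu> * (\<Sum>v\<in>V. (y v)\<^sup>2) \<le> M * (\<Sum>v\<in>V. (y v)\<^sup>2)"
      using Q[of y] by (simp add: sum_distrib_left)
    moreover have "(\<Sum>v\<in>V. (y v)\<^sup>2) > 0"
      using y(1) finite_V by (auto intro: sum_pos2)
    ultimately show "\<mu> \<le> M" by simp
  qed
  then have "radius V E = M" by (simp add: rho_def vs_def)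
  then show thesis using x(1) nz eig Q by (intro that[of x]) simp_all
qed

end

section \<open>Positive eigenvectors and comparison of radii on connected graphs\<close>

locale connected_sgraph = sgraph +
  assumes nonempty: "V \<noteq> {}" and connected: "u \<in> V \<Longrightarrow> v \<in> V \<Longrightarrow> (u, v) \<in> E\<^sup>*"
begin

lemma closed_subset_eq:
  assumes "u \<in> W" "u \<in> V" "\<And>x. x \<in> W \<Longrightarrow> E `` {x} \<subseteq> W"
  shows "V \<subseteq> W"
proof
  fix v assume "v \<in> V"
  then have "(u, v) \<in> E\<^sup>*" using connected assms by blast
  then show "v \<in> W" by induction (use assms in auto)
qed

text \<open>At a zero of a nonnegative eigenvector the neighbour sum is zero, hence so are the
  entries at all neighbours. By connectedness a single zero would spread to all of
  \<open>V\<close>.\<close>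

lemma perron:
  obtains x where "\<And>v. v \<in> V \<Longrightarrow> 0 < x v" "\<And>u. u \<in> V \<Longrightarrow> nbsum E x u = radius V E * x u"
proof -
  obtain x where x: "\<And>v. 0 \<le> x v" "\<exists>v\<in>V. x v \<noteq> 0" "\<And>u. u \<in> V \<Longrightarrow> nbsum E x u = radius V E * x u"
    using perron_nonneg[OF nonempty] by metis
  have "x u \<noteq> 0" if "u \<in> V" for u
  proof
    assume "x u = 0"
    have "E `` {w} \<subseteq> {w \<in> V. x w = 0}" if "w \<in> {w \<in> V. x w = 0}" for w
    proof -
      have "nbsum E x w = 0" using that x(3) by simp
      moreover have "finite (E `` {w})"
        using finite_V E_subset by (auto intro: finite_subset[of _ V])
      ultimately have "\<forall>v\<in>E `` {w}. x v = 0" using x(1) by (simp add: sum_nonneg_eq_0_iff)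
      then show ?thesis using E_subset by auto
    qed
    from closed_subset_eq[OF _ \<open>u \<in> V\<close> this] \<open>x u = 0\<close> \<open>u \<in> V\<close>
    have "V \<subseteq> {w \<in> V. x w = 0}" by blast
    then show False using x(2) by blast
  qed
  then show thesis using that x(1,3) by (metis less_le)
qed

text \<open>Pair the supersolution \<open>w\<close> with the positive eigenvector \<open>x\<close>:
  by self-adjointness \<open>radius V E * s\<close> is the sum of \<open>nbsum E w\<close> weighted
  by \<open>x\<close>, hence at most \<open>r * s\<close>. All weights being positive, one strict
  inequality makes the comparison strict.\<close>

lemma radius_le:
  assumes pos: "\<And>v. v \<in> V \<Longrightarrow> 0 < w v" and super: "\<And>u. u \<in> V \<Longrightarrow> nbsum E w u \<le> r * w u"
  shows "radius V E \<le> r"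
    and "\<exists>u\<in>V. nbsum E w u < r * w u \<Longrightarrow> radius V E < r"
proof -
  obtain x where x: "\<And>v. v \<in> V \<Longrightarrow> 0 < x v" "\<And>u. u \<in> V \<Longrightarrow> nbsum E x u = radius V E * x u"
    using perron by metis
  define s where "s = (\<Sum>v\<in>V. x v * w v)"
  have s: "s > 0" unfolding s_def using finite_V nonempty x pos by (intro sum_pos) auto
  have "radius V E * s = (\<Sum>v\<in>V. w v * nbsum E x v)"
    unfolding s_def by (subst sum_distrib_left, intro sum.cong) (auto simp: x)
  also have "\<dots> = (\<Sum>v\<in>V. x v * nbsum E w v)" by (rule nbsum_sym)
  finally have eq: "radius V E * s = (\<Sum>v\<in>V. x v * nbsum E w v)" .
  have ls: "r * s = (\<Sum>v\<in>V. x v * (r * w v))"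
    unfolding s_def sum_distrib_left by (intro sum.cong) auto
  have "radius V E * s \<le> r * s"
    unfolding eq ls using super x by (intro sum_mono mult_left_mono) (auto intro: less_imp_le)
  then show "radius V E \<le> r" using s by simp
  assume "\<exists>u\<in>V. nbsum E w u < r * w u"
  then have "radius V E * s < r * s"
    unfolding eq ls using super x finite_V
    by (intro sum_strict_mono_ex1) (auto intro!: mult_left_mono intro: less_imp_le)
  then show "radius V E < r" using s by simp
qed

text \<open>The positive eigenvector of \<open>E\<close> is a supersolution for \<open>T\<close>,
  strict at an end of a lost arc.\<close>

lemma radius_spanning_less:
  assumes T: "connected_sgraph V T" "T \<subset> E"
  shows "radius V T < radius V E"
proof -
  interpret T: connected_sgraph V T by fact
  obtain x where x: "\<And>v. v \<in> V \<Longrightarrow> 0 < x v" "\<And>u. u \<in> V \<Longrightarrow> nbsum E x u = radius V E * x u"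
    using perron by metis
  have fin: "finite (E `` {u})" for u
    using finite_V E_subset by (auto intro: finite_subset[of _ V])
  have nonneg: "0 \<le> x v" if "(u, v) \<in> E" for u v
    using that x(1) E_subset by (auto intro: less_imp_le)
  show ?thesis
  proof (rule T.radius_le(2))
    show "0 < x v" if "v \<in> V" for v using that x by blast
    show "nbsum T x u \<le> radius V E * x u" if "u \<in> V" for u
      unfolding x(2)[OF that, symmetric] using fin T nonneg by (intro sum_mono2) auto
    obtain u v where uv: "(u, v) \<in> E" "(u, v) \<notin> T" using T by auto
    then have "u \<in> V" "v \<in> V" using E_subset by auto
    have "nbsum T x u < nbsum E x u"
      by (rule sum_strict_mono2[of _ _ v]) (use fin T nonneg uv x \<open>v \<in> V\<close> in auto)
    then show "\<exists>u\<in>V. nbsum T x u < radius V E * x u" using x \<open>u \<in> V\<close> by auto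
  qed
qed

end

section \<open>Trees\<close>

text \<open>Trees grown by attaching leaves, which provides an induction principle;
  \<open>sym_tree_if_card\<close> recovers this form from connectedness and the number of
  arcs.\<close>

inductive sym_tree :: "'a set \<Rightarrow> 'a rel \<Rightarrow> bool" where
  single: "sym_tree {v} {}"
| leaf: "sym_tree V E \<Longrightarrow> u \<in> V \<Longrightarrow> w \<notin> V \<Longrightarrow> sym_tree (insert w V) (E \<union> {(u, w), (w, u)})"

lemma sym_tree_connected: "sym_tree V E \<Longrightarrow> connected_sgraph V E"
proof (induction rule: sym_tree.induct)
  case (single v)
  show ?case by unfold_locales (auto simp: sym_def irrefl_def)
next
  case (leaf V E u w)
  interpret connected_sgraph V E by fact
  let ?E = "E \<union> {(u, w), (w, u)}"
  have mono: "E\<^sup>* \<subseteq> ?E\<^sup>*" by (intro rtrancl_mono) auto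
  have "(u, w) \<in> ?E\<^sup>*" "(w, u) \<in> ?E\<^sup>*" by auto
  then have to_u: "(x, u) \<in> ?E\<^sup>*" and from_u: "(u, x) \<in> ?E\<^sup>*" if "x \<in> insert w V" for x
    using that connected[of x u] connected[of u x] leaf.hyps mono by auto
  show ?case
  proof unfold_locales
    show "(x, y) \<in> ?E\<^sup>*" if "x \<in> insert w V" "y \<in> insert w V" for x y
      using to_u[OF that(1)] from_u[OF that(2)] by (rule rtrancl_trans)
    show "sym ?E" using symD by (auto simp: sym_def)
    show "irrefl ?E" using irrefl_E leaf.hyps by (auto simp: irrefl_def)
  qed (use finite_V E_subset leaf.hyps in auto)
qed

text \<open>Every edge counts as two arcs; adding 2 on the left avoids truncated
  subtraction.\<close>

lemma sym_tree_card: "sym_tree V E \<Longrightarrow> card E + 2 = 2 * card V"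
proof (induction rule: sym_tree.induct)
  case (leaf V E u w)
  interpret connected_sgraph V E using sym_tree_connected leaf.hyps by blast
  have "finite E" using finite_V E_subset by (meson finite_SigmaI finite_subset)
  moreover have "(u, w) \<notin> E" "(w, u) \<notin> E" "u \<noteq> w" using E_subset leaf.hyps by auto
  ultimately have "card (E \<union> {(u, w), (w, u)}) = card E + 2" by simp
  then show ?case using leaf finite_V by simp
qed simp

definition leaves :: "'a set \<Rightarrow> 'a rel \<Rightarrow> 'a set" where
  "leaves V E = {v \<in> V. card (E `` {v}) = 1}"

section \<open>Counting arcs by degrees, and a lower bound on the radius\<close>

context sgraph
begin

lemma finite_E: "finite E"
  using finite_V E_subset by (meson finite_SigmaI finite_subset)

lemma finite_nb: "finite (E `` {u})"
  using finite_E by (rule finite_Image)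

lemma finite_leaves: "finite (leaves V E)"
  using finite_V by (simp add: leaves_def)

lemma card_arcs_between:
  assumes "S \<subseteq> V"
  shows "card (E \<inter> S \<times> C) = (\<Sum>v\<in>S. card (E `` {v} \<inter> C))"
proof -
  have "E \<inter> S \<times> C = (SIGMA v:S. E `` {v} \<inter> C)" by auto
  moreover have "finite S" using assms finite_V finite_subset by blast
  ultimately show ?thesis using finite_nb by (simp add: card_SigmaI)
qed

lemma sum_degrees: "(\<Sum>v\<in>V. card (E `` {v})) = card E"
proof -
  have "E \<inter> V \<times> UNIV = E" using E_subset by auto
  then show ?thesis using card_arcs_between[of V UNIV] by simp
qed

lemma card_arcs_between_sym: "card (E \<inter> S \<times> C) = card (E \<inter> C \<times> S)"
proof -
  have "(E \<inter> S \<times> C)\<inverse> = E \<inter> C \<times> S" using symD by auto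
  then show ?thesis by (metis card_inverse)
qed

text \<open>Rayleigh quotient of the vector with entry 1 on leaves and 2 elsewhere.\<close>

lemma radius_ge_2:
  assumes "card E + 2 = 2 * card V" "4 \<le> card (leaves V E)"
  shows "2 \<le> radius V E"
proof -
  define l :: "'a \<Rightarrow> real" where "l v = of_bool (v \<in> leaves V E)" for v
  define y where "y v = 2 - l v" for v
  let ?L = "real (card (leaves V E))"
  have V: "V \<noteq> {}" using assms by auto
  have leaf_V: "leaves V E \<inter> V = leaves V E" "V \<inter> leaves V E = leaves V E" by (auto simp: leaves_def)
  have suml: "(\<Sum>v\<in>V. l v) = ?L"
    using finite_V leaf_V by (simp add: l_def of_bool_def flip: sum.inter_restrict)
  have ldeg: "l v * real (card (E `` {v})) = l v" if "v \<in> V" for v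
    by (auto simp: l_def leaves_def)
  have nbl: "(\<Sum>v\<in>V. nbsum E l v) = ?L"
  proof -
    have "(\<Sum>v\<in>V. nbsum E l v) = (\<Sum>v\<in>V. l v * real (card (E `` {v})))"
      using nbsum_sym[of "\<lambda>_. 1" l] by simp
    also have "\<dots> = (\<Sum>v\<in>V. l v)" by (intro sum.cong ldeg refl)
    finally show ?thesis using suml by simp
  qed
  have "8 * real (card V) - 8 - 4 * ?L = 4 * real (card E) - 2 * ?L - 2 * ?L"
    using assms(1) by linarith
  also have "\<dots> = (\<Sum>u\<in>V. 4 * real (card (E `` {u})) - 2 * l u - 2 * nbsum E l u)"
    by (simp add: sum_subtractf suml nbl flip: sum_degrees sum_distrib_left)
  also have "\<dots> = (\<Sum>u\<in>V. \<Sum>v\<in>E `` {u}. 4 - 2 * l u - 2 * l v)"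
  proof (intro sum.cong refl)
    fix u assume "u \<in> V"
    have "(\<Sum>v\<in>E `` {u}. 4 - 2 * l u - 2 * l v)
        = real (card (E `` {u})) * (4 - 2 * l u) - 2 * nbsum E l u"
      unfolding sum_subtractf[of "\<lambda>_. 4 - 2 * l u"] by (simp add: sum_distrib_left)
    also have "\<dots> = 4 * real (card (E `` {u})) - 2 * (l u * real (card (E `` {u}))) - 2 * nbsum E l u"
      by (simp add: algebra_simps)
    finally show "4 * real (card (E `` {u})) - 2 * l u - 2 * nbsum E l u
        = (\<Sum>v\<in>E `` {u}. 4 - 2 * l u - 2 * l v)"
      unfolding ldeg[OF \<open>u \<in> V\<close>] by simp
  qed
  \<comment> \<open>The product \<open>(2 - l u) * (2 - l v)\<close> exceeds the summand by
    \<open>l u * l v\<close>, which is nonnegative.\<close>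
  also have "\<dots> \<le> (\<Sum>u\<in>V. y u * nbsum E y u)"
    unfolding sum_distrib_left by (intro sum_mono) (auto simp: y_def l_def)
  also have "\<dots> \<le> radius V E * (\<Sum>v\<in>V. (y v)\<^sup>2)"
    using perron_nonneg[OF V] by metis
  also have sq: "(\<Sum>v\<in>V. (y v)\<^sup>2) = 4 * real (card V) - 3 * ?L"
  proof -
    have "(\<Sum>v\<in>V. (y v)\<^sup>2) = (\<Sum>v\<in>V. 4 - 3 * l v)"
      by (intro sum.cong) (auto simp: y_def l_def)
    also have "\<dots> = 4 * real (card V) - 3 * ?L"
      by (simp add: sum_subtractf suml flip: sum_distrib_left)
    finally show ?thesis .
  qed
  finally have "8 * real (card V) - 8 - 4 * ?L \<le> radius V E * (4 * real (card V) - 3 * ?L)" .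
  \<comment> \<open>This amounts to \<open>8 \<le> 2 * ?L\<close>, whence the threshold of four
    leaves.\<close>
  moreover have "2 * (4 * real (card V) - 3 * ?L) \<le> 8 * real (card V) - 8 - 4 * ?L"
    using of_nat_mono[OF assms(2), where 'a = real] by simp
  ultimately have "2 * (4 * real (card V) - 3 * ?L) \<le> radius V E * (4 * real (card V) - 3 * ?L)"
    by (rule order_trans[rotated])
  moreover have "card (leaves V E) \<le> card V"
    using finite_V by (auto intro!: card_mono simp: leaves_def)
  then have "4 * real (card V) - 3 * ?L > 0" using assms(2) by linarith
  ultimately show ?thesis by (rule mult_right_le_imp_le)
qed

end

section \<open>Spanning trees and the leaf bound for dissociation sets\<close>

context connected_sgraph
begin

text \<open>Take a maximal vertex set \<open>W\<close> spanned by a tree inside \<open>E\<close>. An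
  edge leaving \<open>W\<close> could be attached as a new leaf, so \<open>W\<close> is closed under
  neighbours and equals \<open>V\<close>.\<close>

lemma spanning_tree: "\<exists>T\<subseteq>E. sym_tree V T"
proof -
  let ?\<W> = "{W. W \<subseteq> V \<and> (\<exists>T\<subseteq>E. sym_tree W T)}"
  obtain v where "v \<in> V" using nonempty by blast
  then have "{v} \<in> ?\<W>" by (auto intro!: exI[of _ "{}"] sym_tree.single)
  then have "?\<W> \<noteq> {}" by blast
  moreover have "finite ?\<W>" using finite_V by simp
  ultimately have "\<exists>W\<in>?\<W>. \<forall>W'\<in>?\<W>. W \<subseteq> W' \<longrightarrow> W = W'"
    by (rule finite_has_maximal[rotated])
  then obtain W where W: "W \<in> ?\<W>" and max: "\<forall>W'\<in>?\<W>. W \<subseteq> W' \<longrightarrow> W = W'"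
    by (rule bexE)
  from W obtain T where T: "T \<subseteq> E" "sym_tree W T" by auto
  have "V \<subseteq> W"
  proof -
    have "W \<noteq> {}" using sym_tree_connected[OF T(2)] connected_sgraph.nonempty by blast
    then obtain u where "u \<in> W" by blast
    moreover have closed: "E `` {x} \<subseteq> W" if "x \<in> W" for x
    proof (rule ccontr)
      assume "\<not> E `` {x} \<subseteq> W"
      then obtain w where w: "(x, w) \<in> E" "w \<notin> W" by blast
      have "sym_tree (insert w W) (T \<union> {(x, w), (w, x)})"
        using T(2) that w by (intro sym_tree.leaf)
      moreover have "T \<union> {(x, w), (w, x)} \<subseteq> E" using T w symD by blast
      moreover have "insert w W \<subseteq> V" using W w E_subset by blast
      ultimately have "insert w W \<in> ?\<W>" by (intro CollectI conjI exI)
      from bspec[OF max this] show False using w(2) by auto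
    qed
    ultimately show ?thesis using W by (intro closed_subset_eq[OF _ _ closed]) auto
  qed
  then have "W = V" using W by blast
  then show ?thesis using T by blast
qed

lemma card_arcs_ge: "2 * card V \<le> card E + 2"
proof -
  obtain T where T: "T \<subseteq> E" "sym_tree V T" using spanning_tree by blast
  have "card T \<le> card E" using T finite_E by (intro card_mono)
  then show ?thesis using sym_tree_card[OF T(2)] by simp
qed

text \<open>A spanning tree already has this many arcs, so it is all of \<open>E\<close>. Rehanging
  preserves connectedness and the number of arcs, and through this lemma the inductive structure
  too.\<close>

lemma sym_tree_if_card:
  assumes "card E + 2 = 2 * card V"
  shows "sym_tree V E"
proof -
  obtain T where T: "T \<subseteq> E" "sym_tree V T" using spanning_tree by blast
  then have "card T = card E" using sym_tree_card assms by fastforce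
  then have "T = E" using T finite_E by (intro card_subset_eq)
  then show ?thesis using T by simp
qed

lemma degree_pos:
  assumes "2 \<le> card V" "v \<in> V"
  shows "1 \<le> card (E `` {v})"
proof (rule ccontr)
  assume "\<not> ?thesis"
  then have "E `` {v} = {}" using finite_nb[of v] by (metis One_nat_def Suc_leI card_gt_0_iff)
  then have "V \<subseteq> {v}" using closed_subset_eq[of v "{v}"] assms by auto
  then show False using assms card_mono[of "{v}" V] by simp
qed

text \<open>
  Double counting of the edges leaving \<open>S\<close>: every vertex of \<open>S\<close> sends all but at most one of its
  edges to the complement.
\<close>

lemma tree_dissociation_bound:
  assumes tree: "card E + 2 = 2 * card V" and n: "2 \<le> card V"
    and S: "S \<subseteq> V" "\<And>v. v \<in> S \<Longrightarrow> card (E `` {v} \<inter> S) \<le> 1"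
  shows "3 * card S + 2 \<le> 2 * card V + 2 * card (leaves V E)"
proof -
  define C where "C = V - S"
  have fS: "finite S" using S finite_V finite_subset by blast
  have "(\<Sum>v\<in>S. card (E `` {v})) \<le> (\<Sum>v\<in>S. card (E `` {v} \<inter> C) + 1)"
  proof (intro sum_mono)
    fix v assume v: "v \<in> S"
    have "E `` {v} = (E `` {v} \<inter> C) \<union> (E `` {v} \<inter> S)" using E_subset by (auto simp: C_def)
    then have "card (E `` {v}) \<le> card (E `` {v} \<inter> C) + card (E `` {v} \<inter> S)"
      by (metis card_Un_le)
    then show "card (E `` {v}) \<le> card (E `` {v} \<inter> C) + 1" using S(2)[OF v] by simp
  qed
  also have "\<dots> = card (E \<inter> C \<times> S) + card S"
    by (simp only: sum.distrib flip: card_arcs_between[OF S(1)]) (simp add: card_arcs_between_sym)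
  also have "card (E \<inter> C \<times> S) = (\<Sum>v\<in>C. card (E `` {v} \<inter> S))"
    by (rule card_arcs_between) (simp add: C_def)
  also have "\<dots> \<le> (\<Sum>v\<in>C. card (E `` {v}))"
    by (intro sum_mono card_mono finite_nb) auto
  finally have 1: "(\<Sum>v\<in>S. card (E `` {v})) \<le> (\<Sum>v\<in>C. card (E `` {v})) + card S" by simp
  have 2: "(\<Sum>v\<in>S. card (E `` {v})) + (\<Sum>v\<in>C. card (E `` {v})) = card E"
    unfolding sum_degrees[symmetric] C_def using sum.subset_diff[OF S(1) finite_V] by (metis add.commute)
  \<comment> \<open>All degrees are at least 2 except at leaves, where one unit is missing; so
    \<open>2 * card S\<close> exceeds the degree sum over \<open>S\<close> by at most the number of
    leaves.\<close>
  have "2 * card S = (\<Sum>v\<in>S. 2)" by simp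
  also have "\<dots> \<le> (\<Sum>v\<in>S. card (E `` {v}) + of_bool (v \<in> leaves V E))"
  proof (intro sum_mono)
    fix v assume "v \<in> S"
    then show "2 \<le> card (E `` {v}) + of_bool (v \<in> leaves V E)"
      using degree_pos[OF n, of v] S(1) by (auto simp: leaves_def)
  qed
  also have "\<dots> = (\<Sum>v\<in>S. card (E `` {v})) + card (S \<inter> leaves V E)"
    using fS by (simp add: sum.distrib of_bool_def flip: sum.inter_restrict)
  also have "card (S \<inter> leaves V E) \<le> card (leaves V E)"
    by (intro card_mono finite_leaves) auto
  finally show ?thesis using 1 2 tree by linarith
qed

end

section \<open>Rehanging pendant paths\<close>

text \<open>The whole neighbourhood of each path vertex is prescribed: its predecessor, and its
  successor if there is one. \<open>set (take 1 as)\<close> is empty at the free end, and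
  \<open>v\<close> is the vertex at which the path hangs.\<close>

primrec pendant_path :: "'a rel \<Rightarrow> 'a \<Rightarrow> 'a list \<Rightarrow> bool" where
  "pendant_path E v [] \<longleftrightarrow> True"
| "pendant_path E v (a # as) \<longleftrightarrow> E `` {a} = insert v (set (take 1 as)) \<and> pendant_path E a as"

lemma pendant_path_nth:
  assumes "pendant_path E v as" "i < length as"
  shows "E `` {as ! i} = insert ((v # as) ! i) (if Suc i < length as then {as ! Suc i} else {})"
  using assms
proof (induction as arbitrary: v i)
  case (Cons a as)
  then show ?case by (cases i; cases as) auto
qed simp

lemma pendant_path_nb_nonempty: "pendant_path E v as \<Longrightarrow> x \<in> set as \<Longrightarrow> E `` {x} \<noteq> {}"
  by (metis in_set_conv_nth insert_not_empty pendant_path_nth)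

lemma pendant_path_nb_subset: "pendant_path E v as \<Longrightarrow> x \<in> set as \<Longrightarrow> E `` {x} \<subseteq> set (v # as)"
proof (induction as arbitrary: v)
  case (Cons a as)
  have "set (take 1 as) \<subseteq> set as" by (rule set_take_subset)
  with Cons show ?case by fastforce
qed simp

lemma pendant_path_cong:
  "pendant_path E v as \<Longrightarrow> (\<And>x. x \<in> set as \<Longrightarrow> E' `` {x} = E `` {x}) \<Longrightarrow> pendant_path E' v as"
  by (induction as arbitrary: v) auto

lemma pendant_path_suffix: "pendant_path E v (xs @ u # ys) \<Longrightarrow> pendant_path E u ys"
  by (induction xs arbitrary: v) auto

lemma pendant_path_snoc:
  assumes "pendant_path E v (xs @ [u])" "u \<notin> set xs"
    and "\<And>x. x \<in> set xs \<Longrightarrow> E' `` {x} = E `` {x}" "E' `` {u} = insert w (E `` {u})" "E' `` {w} = {u}"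
  shows "pendant_path E' v (xs @ [u, w])"
  using assms
proof (induction xs arbitrary: v)
  case (Cons x xs)
  then have "pendant_path E' x (xs @ [u, w])" by simp
  moreover have "take 1 (xs @ [u, w]) = take 1 (xs @ [u])" by (cases xs) auto
  ultimately show ?case using Cons.prems(1,3) by simp
qed auto

text \<open>Together with \<open>v\<close> the paths may form the whole graph; that \<open>v\<close>
  branches once there are three leaves is shown in \<open>card_nb_branch_vertex\<close>.\<close>

definition two_pendant_paths :: "'a rel \<Rightarrow> 'a \<Rightarrow> 'a list \<Rightarrow> 'a list \<Rightarrow> bool" where
  "two_pendant_paths E v as bs \<longleftrightarrow> as \<noteq> [] \<and> bs \<noteq> [] \<and> distinct (v # as @ bs) \<and>
     pendant_path E v as \<and> pendant_path E v bs"

lemma two_pendant_paths_sym: "two_pendant_paths E v as bs \<Longrightarrow> two_pendant_paths E v bs as"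
  by (auto simp: two_pendant_paths_def)

text \<open>
  If the new leaf is attached in the interior of one of the two paths, then its neighbour is the
  new branching vertex; otherwise \<open>v\<close> still works.
\<close>

lemma two_pendant_paths_add_leaf:
  assumes p: "two_pendant_paths E v as bs" and E: "E \<subseteq> V \<times> V" and w: "w \<notin> V" and u: "u \<in> V"
    and E': "E' = E \<union> {(u, w), (w, u)}" and as: "u \<notin> set bs"
  shows "\<exists>v as bs. two_pendant_paths E' v as bs"
proof -
  have nb: "E' `` {x} = E `` {x}" if "x \<noteq> u" "x \<noteq> w" for x using that E' by auto
  have nbu: "E' `` {u} = insert w (E `` {u})" using E E' w u by auto
  have nbw: "E' `` {w} = {u}" using E E' w by auto
  have in_V: "set as \<subseteq> V" "set bs \<subseteq> V"
    using p E pendant_path_nb_nonempty[of E v] unfolding two_pendant_paths_def by blast+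
  have "v \<in> V"
  proof (cases as)
    case (Cons a as')
    then have "(a, v) \<in> E" using p by (auto simp: two_pendant_paths_def)
    then show ?thesis using E by auto
  qed (use p in \<open>simp add: two_pendant_paths_def\<close>)
  have new: "w \<notin> set as" "w \<notin> set bs" "w \<noteq> v" "w \<noteq> u" using in_V w u \<open>v \<in> V\<close> by auto
  have cong: "pendant_path E' x xs" if "pendant_path E x xs" "u \<notin> set xs" "w \<notin> set xs" for x xs
  proof (rule pendant_path_cong[OF that(1)])
    fix y assume "y \<in> set xs"
    then show "E' `` {y} = E `` {y}" using that by (intro nb) auto
  qed
  show ?thesis
  proof (cases "u \<in> set as")
    case False
    have "pendant_path E' v as" "pendant_path E' v bs"
      using p False as new by (simp_all add: two_pendant_paths_def cong)
    then have "two_pendant_paths E' v as bs" using p by (simp add: two_pendant_paths_def)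
    then show ?thesis by blast
  next
    case True
    then obtain xs ys where as_eq: "as = xs @ u # ys" by (meson split_list)
    show ?thesis
    proof (cases "ys = []")
      case True
      have "pendant_path E' v (xs @ [u, w])"
      proof (rule pendant_path_snoc[of E])
        fix y assume "y \<in> set xs"
        then show "E' `` {y} = E `` {y}"
          using p new as_eq by (intro nb) (auto simp: two_pendant_paths_def)
      qed (use p as_eq True nbu nbw in \<open>simp_all add: two_pendant_paths_def\<close>)
      moreover have "pendant_path E' v bs"
        using p as new by (simp add: two_pendant_paths_def cong)
      ultimately have "two_pendant_paths E' v (xs @ [u, w]) bs"
        using p as_eq True new by (auto simp: two_pendant_paths_def)
      then show ?thesis by blast
    next
      case False
      have "pendant_path E u ys"
        using p unfolding two_pendant_paths_def as_eq by (blast intro: pendant_path_suffix)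
      then have "pendant_path E' u ys"
        using p as_eq new by (intro cong) (auto simp: two_pendant_paths_def)
      then have "two_pendant_paths E' u ys [w]"
        using p as_eq False new nbw by (auto simp: two_pendant_paths_def)
      then show ?thesis by blast
    qed
  qed
qed

text \<open>Induction along the leaf attachments: the vertex that receives the new leaf lies on at
  most one of the two disjoint paths, and by symmetry this may be taken to be the first.\<close>

lemma sym_tree_two_pendant_paths:
  "sym_tree V E \<Longrightarrow> 3 \<le> card V \<Longrightarrow> \<exists>v as bs. two_pendant_paths E v as bs"
proof (induction rule: sym_tree.induct)
  case (leaf V E u w)
  let ?E = "E \<union> {(u, w), (w, u)}"
  interpret connected_sgraph V E using sym_tree_connected leaf.hyps by blast
  show ?case
  proof (cases "3 \<le> card V")
    case True
    then obtain v as bs where p: "two_pendant_paths E v as bs" using leaf.IH by blast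
    show ?thesis
    proof (cases "u \<in> set bs")
      case False
      show ?thesis
        by (rule two_pendant_paths_add_leaf[OF p E_subset leaf.hyps(3,2) refl False])
    next
      case True
      then have "u \<notin> set as" using p by (auto simp: two_pendant_paths_def)
      from two_pendant_paths_add_leaf[OF two_pendant_paths_sym[OF p] E_subset leaf.hyps(3,2) refl this]
      show ?thesis .
    qed
  next
    case False
    \<comment> \<open>Base case: the two old vertices are joined, so \<open>u\<close> becomes the
      middle of a path on three vertices.\<close>
    then have V2: "card V = 2" using leaf.prems leaf.hyps finite_V by simp
    then obtain x where x: "V = {u, x}" "x \<noteq> u"
      using leaf.hyps(2) by (metis card_2_iff doubleton_eq_iff insert_iff singletonD)
    have "(u, x) \<in> E"
    proof (rule ccontr)
      assume "(u, x) \<notin> E"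
      then have "E `` {u} \<subseteq> {u}" using E_subset x by auto
      then have "V \<subseteq> {u}" using closed_subset_eq[of u "{u}"] x by auto
      then show False using x by auto
    qed
    then have "(x, u) \<in> E" by (rule symD)
    moreover have "w \<noteq> x" "w \<noteq> u" "(w, u) \<notin> E" using leaf.hyps x E_subset by auto
    moreover have "E `` {x} \<subseteq> {u}" using E_subset x irrefl_E by (auto simp: irrefl_def)
    moreover have "E `` {w} = {}" using E_subset leaf.hyps by auto
    ultimately have "?E `` {x} = {u}" "?E `` {w} = {u}" using x(2) by auto
    then have "two_pendant_paths ?E u [x] [w]"
      using x \<open>w \<noteq> x\<close> \<open>w \<noteq> u\<close> by (auto simp: two_pendant_paths_def)
    then show ?thesis by blast
  qed
qed simp

text \<open>With \<open>r = 2 cosh t\<close> this is \<open>sinh (n t) / sinh t\<close>.\<close>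

fun path_seq :: "real \<Rightarrow> nat \<Rightarrow> real" where
  "path_seq r 0 = 0"
| "path_seq r (Suc 0) = 1"
| "path_seq r (Suc (Suc n)) = r * path_seq r (Suc n) - path_seq r n"

text \<open>For \<open>r \<ge> 2\<close> and nonnegative terms the recurrence makes the increments
  nondecreasing, and the first increment is 1.\<close>

lemma path_seq_growth:
  assumes "2 \<le> r"
  shows "0 \<le> path_seq r n \<and> path_seq r n + 1 \<le> path_seq r (Suc n)"
proof (induction n)
  case (Suc n)
  have "2 * path_seq r (Suc n) \<le> r * path_seq r (Suc n)"
    using assms Suc by (intro mult_right_mono) auto
  moreover have "path_seq r (Suc (Suc n)) = r * path_seq r (Suc n) - path_seq r n" by simp
  ultimately show ?case using Suc by linarith
qed simp

text \<open>The eigenvalue equations, read from the free end towards \<open>v\<close>, are the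
  recurrence of \<open>path_seq\<close>; its initial 0 stands for the absent vertex beyond the free
  end.\<close>

lemma eigenvector_pendant_path:
  assumes "pendant_path E v (a # as)" "distinct (v # a # as)"
    and "\<And>u. u \<in> set (a # as) \<Longrightarrow> nbsum E z u = r * z u"
  shows "z v = path_seq r (length as + 2) * z (last (a # as)) \<and>
         z a = path_seq r (length as + 1) * z (last (a # as))"
  using assms
proof (induction as arbitrary: v a)
  case Nil
  then have "nbsum E z a = r * z a" "E `` {a} = {v}" by auto
  then show ?case by (simp add: numeral_2_eq_2)
next
  case (Cons c cs)
  have IH: "z a = path_seq r (length cs + 2) * z (last (c # cs)) \<and>
            z c = path_seq r (length cs + 1) * z (last (c # cs))"
    using Cons.prems by (intro Cons.IH) auto
  have "E `` {a} = {v, c}" "v \<noteq> c" using Cons.prems by auto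
  then have "nbsum E z a = z v + z c" by simp
  moreover have "nbsum E z a = r * z a" by (rule Cons.prems) simp
  ultimately have "z v = r * z a - z c" by simp
  then show ?case using IH by (simp add: algebra_simps numeral_2_eq_2)
qed

context connected_sgraph
begin

text \<open>If \<open>v\<close> had only the first vertices of the two paths as neighbours, then
  \<open>v\<close> and the paths would be closed under neighbours and hence the whole graph: a path,
  with at most two leaves.\<close>

lemma card_nb_branch_vertex:
  assumes p: "two_pendant_paths E v as bs" and L: "3 \<le> card (leaves V E)"
  shows "3 \<le> card (E `` {v})"
proof (rule ccontr)
  assume small: "\<not> ?thesis"
  have ne: "as \<noteq> []" "bs \<noteq> []" and dist: "distinct (v # as @ bs)"
    and pa: "pendant_path E v as" and pb: "pendant_path E v bs"
    using p by (auto simp: two_pendant_paths_def)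
  have hd: "(v, hd xs) \<in> E" if "pendant_path E v xs" "xs \<noteq> []" for xs
  proof (cases xs)
    case (Cons x ys)
    then have "(x, v) \<in> E" using that by auto
    then show ?thesis using Cons symD by simp
  qed (use that in simp)
  have hds: "hd as \<noteq> hd bs" using ne dist by (auto dest: hd_in_set)
  have sub: "{hd as, hd bs} \<subseteq> E `` {v}" using hd pa pb ne by auto
  have nbv: "{hd as, hd bs} = E `` {v}"
    by (rule card_seteq[OF finite_nb sub]) (use small hds in simp)
  have inner: "card (E `` {x}) = 2" if x: "x \<in> set xs" "x \<noteq> last xs" "pendant_path E v xs" "distinct (v # xs)"
    for x xs
  proof -
    obtain i where i: "i < length xs" "x = xs ! i" using x(1) by (metis in_set_conv_nth)
    have "Suc i < length xs"
      using i x(2) by (metis Suc_lessI diff_Suc_1 last_conv_nth length_0_conv less_nat_zero_code)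
    moreover have "(v # xs) ! i \<noteq> (v # xs) ! Suc (Suc i)"
      using x(4) \<open>Suc i < length xs\<close> by (subst nth_eq_iff_index_eq) auto
    ultimately show ?thesis using pendant_path_nth[OF x(3) i(1)] i(2) by simp
  qed
  let ?W = "insert v (set as \<union> set bs)"
  have "V \<subseteq> ?W"
  proof (rule closed_subset_eq)
    show "v \<in> ?W" by simp
    show "v \<in> V" using sub E_subset by auto
    show "E `` {x} \<subseteq> ?W" if x: "x \<in> ?W" for x
    proof -
      consider "x = v" | "x \<in> set as" | "x \<in> set bs" using x by blast
      then show ?thesis
      proof cases
        case 1
        then show ?thesis unfolding 1 nbv[symmetric] using hd_in_set[OF ne(1)] hd_in_set[OF ne(2)] by blast
      next
        case 2
        then show ?thesis using pendant_path_nb_subset[OF pa 2] by auto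
      next
        case 3
        then show ?thesis using pendant_path_nb_subset[OF pb 3] by auto
      qed
    qed
  qed
  moreover have "v \<notin> leaves V E" using nbv[symmetric] hds by (simp add: leaves_def)
  moreover have "x \<notin> leaves V E" if "x \<in> set as" "x \<noteq> last as" for x
    using inner[OF that pa] dist by (simp add: leaves_def)
  moreover have "x \<notin> leaves V E" if "x \<in> set bs" "x \<noteq> last bs" for x
    using inner[OF that pb] dist by (simp add: leaves_def)
  moreover have "leaves V E \<subseteq> V" by (auto simp: leaves_def)
  ultimately have "leaves V E \<subseteq> {last as, last bs}" by blast
  then have "card (leaves V E) \<le> card {last as, last bs}" by (intro card_mono) auto
  also have "\<dots> \<le> 2" by (simp add: card_insert_if)
  finally show False using L by simp
qed

end

section \<open>The rehanging step and its effect on connectedness, leaves and radius\<close>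

locale rehang = connected_sgraph V E for V :: "'a set" and E +
  fixes v :: 'a and as bs :: "'a list"
  assumes paths: "two_pendant_paths E v as bs" and deg_v: "3 \<le> card (E `` {v})"
begin

definition l where "l = last as"
definition b where "b = hd bs"
text \<open>Only the edge between \<open>v\<close> and \<open>b\<close> is exchanged; the other
  edges of \<open>bs\<close> stay, so the whole second path moves to the far end of the
  first.\<close>

definition E' where "E' = E - {(v, b), (b, v)} \<union> {(l, b), (b, l)}"

lemma path_as: "as \<noteq> []" "distinct (v # as)" "pendant_path E v as"
  and path_bs: "bs \<noteq> []" "distinct (v # bs)" "pendant_path E v bs"
  and b_notin: "b \<noteq> v" "b \<notin> set as"
  using paths by (auto simp: two_pendant_paths_def b_def)

lemma l_in: "l \<in> set as" "l \<noteq> v" "l \<noteq> b"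
proof -
  show l: "l \<in> set as" using path_as by (simp add: l_def)
  show "l \<noteq> v" using l path_as by auto
  show "l \<noteq> b" using l b_notin by auto
qed

lemma nb_nth: "i < length as \<Longrightarrow>
    E `` {as ! i} = insert ((v # as) ! i) (if Suc i < length as then {as ! Suc i} else {})"
  by (rule pendant_path_nth[OF path_as(3)])

lemma l_nth: "l = as ! (length as - 1)" "length as - 1 < length as"
  using path_as by (auto simp: l_def last_conv_nth)

lemma nb_l: "E `` {l} = {(v # as) ! (length as - 1)}"
  using nb_nth[OF l_nth(2)] l_nth by auto

lemma v_in_V: "v \<in> V" and b_in_V: "b \<in> V" and vb: "(v, b) \<in> E" "(b, v) \<in> E"
proof -
  have "(hd bs, v) \<in> E" using path_bs by (cases bs) auto
  then show bv: "(b, v) \<in> E" by (simp add: b_def)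
  then show "(v, b) \<in> E" by (rule symD)
  show "v \<in> V" "b \<in> V" using bv E_subset by auto
qed

lemma as_subset_V: "set as \<subseteq> V"
proof
  fix x assume "x \<in> set as"
  then have "E `` {x} \<noteq> {}" using path_as by (intro pendant_path_nb_nonempty)
  then show "x \<in> V" using E_subset by auto
qed

lemma as_nb_in: "x \<in> set as \<Longrightarrow> (y, x) \<in> E \<Longrightarrow> y \<in> set (v # as)"
  using pendant_path_nb_subset[OF path_as(3)] symD by blast

lemma lb_notin: "(l, b) \<notin> E" "(b, l) \<notin> E"
  using as_nb_in[OF l_in(1), of b] symD b_notin by auto

lemma nb': "E' `` {v} = E `` {v} - {b}" "E' `` {b} = insert l (E `` {b} - {v})"
  "E' `` {l} = insert b (E `` {l})" "x \<noteq> v \<Longrightarrow> x \<noteq> b \<Longrightarrow> x \<noteq> l \<Longrightarrow> E' `` {x} = E `` {x}"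
  using l_in b_notin by (auto simp: E'_def)

lemma card_E': "card E' = card E"
proof -
  have "card (E - {(v, b), (b, v)}) = card E - 2"
    using vb b_notin by (subst card_Diff_subset) auto
  moreover have "card E \<ge> 2"
    using vb b_notin finite_E card_mono[of E "{(v, b), (b, v)}"] by auto
  moreover have "card E' = card (E - {(v, b), (b, v)}) + 2"
    using lb_notin l_in finite_E by (simp add: E'_def)
  ultimately show ?thesis by simp
qed

lemma sgraph_E': "sgraph V E'"
proof unfold_locales
  show "E' \<subseteq> V \<times> V" using E_subset b_in_V as_subset_V l_in by (auto simp: E'_def)
  show "sym E'" using symD by (auto simp: E'_def sym_def)
  show "irrefl E'" using irrefl_E l_in by (auto simp: E'_def irrefl_def)
qed (rule finite_V)

text \<open>The lost edge is replaced by a walk: along \<open>as\<close> from \<open>v\<close> to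
  \<open>l\<close>, then over the new edge to \<open>b\<close>.\<close>

lemma connected_E': "connected_sgraph V E'"
proof -
  interpret E': sgraph V E' by (rule sgraph_E')
  have "(v, (v # as) ! i) \<in> E'\<^sup>*" if "i \<le> length as" for i
    using that
  proof (induction i)
    case (Suc i)
    then have i: "i < length as" by simp
    then have "(as ! i, (v # as) ! i) \<in> E" using nb_nth[OF i] by auto
    moreover have "(v # as) ! i \<in> set (v # as)" by (rule nth_mem) (use i in simp)
    then have "(v # as) ! i \<noteq> b" using b_notin by auto
    moreover have "as ! i \<noteq> b" using b_notin(2) nth_mem[OF i] by metis
    ultimately have "(as ! i, (v # as) ! i) \<in> E'" by (auto simp: E'_def)
    then have "((v # as) ! i, as ! i) \<in> E'" by (rule E'.symD)
    with Suc show ?case by (auto intro: rtrancl_into_rtrancl)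
  qed simp
  from this[of "length as"] have "(v, l) \<in> E'\<^sup>*" using path_as by (simp add: l_def last_conv_nth nth_Cons')
  moreover have "(l, b) \<in> E'" by (auto simp: E'_def)
  ultimately have "(v, b) \<in> E'\<^sup>*" by (rule rtrancl_into_rtrancl)
  moreover from this have "(b, v) \<in> E'\<^sup>*" by (rule Relation.symD[OF sym_rtrancl[OF E'.sym_E]])
  ultimately have "E \<subseteq> E'\<^sup>*" by (auto simp: E'_def)
  then have "E\<^sup>* \<subseteq> E'\<^sup>*" by (rule rtrancl_subset_rtrancl)
  then show ?thesis using connected nonempty by unfold_locales auto
qed

text \<open>The old leaf \<open>l\<close> gains a second neighbour. No leaf arises, since
  \<open>v\<close> keeps at least two neighbours and the degree of \<open>b\<close> is
  unchanged.\<close>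

lemma card_leaves_E': "card (leaves V E') < card (leaves V E)"
proof (rule psubset_card_mono[OF finite_leaves])
  have l: "l \<in> leaves V E" using l_in as_subset_V nb_l by (auto simp: leaves_def)
  have "b \<notin> E `` {l}" using lb_notin by simp
  then have "card (E' `` {l}) = 2" unfolding nb'(3) nb_l by simp
  then have "l \<notin> leaves V E'" by (simp add: leaves_def)
  moreover have "x \<in> leaves V E" if "x \<in> leaves V E'" "x \<noteq> l" for x
  proof -
    have "x \<noteq> v"
    proof
      assume "x = v"
      then have "card (E `` {v} - {b}) = 1" using that nb'(1) by (simp add: leaves_def)
      moreover have "b \<in> E `` {v}" using vb by simp
      ultimately show False using deg_v card_Diff_singleton[of b "E `` {v}"] by linarith
    qed
    moreover have "card (E' `` {b}) = card (E `` {b})"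
    proof -
      have "l \<notin> E `` {b} - {v}" using lb_notin by simp
      then have "card (E' `` {b}) = Suc (card (E `` {b} - {v}))"
        unfolding nb'(2) using finite_nb[of b] by simp
      also have "\<dots> = card (E `` {b})" using vb by (intro card_Suc_Diff1 finite_nb) simp
      finally show ?thesis .
    qed
    moreover have "E' `` {x} = E `` {x}" if "x \<noteq> b"
      by (rule nb'(4)) fact+
    ultimately show ?thesis using \<open>x \<in> leaves V E'\<close> by (cases "x = b") (simp_all add: leaves_def)
  qed
  ultimately show "leaves V E' \<subset> leaves V E" using l by blast
qed

text \<open>
  If \<open>z\<close> is the Perron vector of \<open>E\<close> and \<open>c\<close> the solution of the eigenvalue recurrence along
  \<open>as\<close> with boundary values 0 at \<open>v\<close> and 1 at \<open>b\<close>, then \<open>z + z b * c\<close> is a positive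
  supersolution for \<open>E'\<close>.
\<close>

lemma radius_E':
  assumes "2 \<le> radius V E"
  shows "radius V E' \<le> radius V E"
proof -
  define r where "r = radius V E"
  define p where "p = length as"
  define s where "s = path_seq r"
  obtain z where pos: "\<And>x. x \<in> V \<Longrightarrow> 0 < z x" and z: "\<And>x. x \<in> V \<Longrightarrow> nbsum E z x = r * z x"
    using perron unfolding r_def by metis
  have growth: "0 \<le> s n" "s n + 1 \<le> s (Suc n)" for n
    using path_seq_growth[of r n] assms by (auto simp: s_def r_def)
  have S: "1 \<le> s (p + 1)" using growth[of p] by simp
  have zv: "z v = s (p + 1) * z l"
  proof (cases as)
    case (Cons a as')
    have "z v = path_seq r (length as' + 2) * z (last (a # as'))"
      by (rule conjunct1[OF eigenvector_pendant_path]) (use path_as z as_subset_V Cons in auto)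
    then have "z v = s (length as' + 2) * z l" unfolding Cons[symmetric] l_def s_def .
    moreover have "p = length as' + 1" using Cons by (simp add: p_def)
    ultimately show ?thesis by simp
  qed (use path_as in simp)
  \<comment> \<open>Along \<open>bs\<close> the eigenvector is a positive multiple of
    \<open>path_seq\<close>, which increases from the free end towards \<open>v\<close>.\<close>
  have zb: "z b \<le> z v"
  proof (cases bs)
    case (Cons a bs')
    have V: "set bs \<subseteq> V"
      using pendant_path_nb_nonempty[OF path_bs(3)] E_subset by blast
    have "z v = path_seq r (length bs' + 2) * z (last (a # bs')) \<and>
          z a = path_seq r (length bs' + 1) * z (last (a # bs'))"
      by (rule eigenvector_pendant_path) (use path_bs z V Cons in auto)
    moreover have "hd bs = a" using Cons by simp
    then have "b = a" by (simp add: b_def)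
    ultimately have "z v = s (length bs' + 2) * z (last bs)" "z b = s (length bs' + 1) * z (last bs)"
      unfolding Cons[symmetric] s_def by simp_all
    moreover have "0 < z (last bs)" using V last_in_set[OF path_bs(1)] by (intro pos) blast
    ultimately show ?thesis using growth(2)[of "length bs' + 1"] by simp
  qed (use path_bs in simp)
  have zb0: "0 < z b" "0 < z l" using pos b_in_V l_in as_subset_V by auto

  \<comment> \<open>As the vertices of \<open>v # as\<close> are distinct, at most one summand
    survives: position \<open>i\<close> gets \<open>s i / s (p + 1)\<close>. Position 0 is
    \<open>v\<close>, with value 0; one position past \<open>l\<close> the value would be 1.\<close>
  define c where "c x = (\<Sum>i\<le>p. if (v # as) ! i = x then s i else 0) / s (p + 1)" for x
  have c_nth: "c ((v # as) ! i) = s i / s (p + 1)" if "i \<le> p" for i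
  proof -
    have "(v # as) ! j = (v # as) ! i \<longleftrightarrow> j = i" if "j \<le> p" for j
      using path_as(2) \<open>i \<le> p\<close> that by (subst nth_eq_iff_index_eq) (auto simp: p_def)
    then have "(\<Sum>j\<le>p. if (v # as) ! j = (v # as) ! i then s j else 0) = (\<Sum>j\<le>p. if j = i then s j else 0)"
      by (intro sum.cong) auto
    also have "\<dots> = s i" using that by simp
    finally show ?thesis by (simp add: c_def)
  qed
  have c_out: "c x = 0" if "x \<notin> set as" for x
  proof (cases "x = v")
    case True
    then show ?thesis using c_nth[of 0] by (simp add: s_def)
  next
    case False
    have "(v # as) ! i \<noteq> x" if "i \<le> p" for i
      using False \<open>x \<notin> set as\<close> that nth_mem[of i "v # as"] by (auto simp: p_def)
    then show ?thesis by (simp add: c_def)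
  qed
  have c_nonneg: "0 \<le> c x" for x
    unfolding c_def using growth S by (intro divide_nonneg_nonneg sum_nonneg) auto
  have p1: "1 \<le> p" using path_as by (cases as) (auto simp: p_def)
  have c_as: "c (as ! i) = s (Suc i) / s (p + 1)" if "i < p" for i
    using c_nth[of "Suc i"] that by simp
  have cl: "c l = s p / s (p + 1)"
  proof -
    have "Suc (p - 1) = p" "as ! (p - 1) = l" using p1 l_nth(1) by (simp_all add: p_def)
    then show ?thesis using c_as[of "p - 1"] p1 by simp
  qed
  define w where "w x = z x + z b * c x" for x
  have nbw: "nbsum F w x = nbsum F z x + z b * nbsum F c x" for F x
    by (simp add: w_def sum.distrib sum_distrib_left)
  have super: "nbsum E' w x \<le> r * w x" if x: "x \<in> V" for x
  proof -
    consider "x = v" | "x = b" | "x \<in> set as" | "x \<noteq> v" "x \<noteq> b" "x \<notin> set as" by blast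
    then show ?thesis
    proof cases
      \<comment> \<open>At \<open>v\<close> the entry \<open>z b\<close> is lost, and the correction
        enters only through the first vertex of \<open>as\<close>, where it is at most
        \<open>z b\<close>.\<close>
      case 1
      have first: "as ! 0 \<in> E `` {v} - {b}"
        using nb_nth[of 0] path_as b_notin symD by (auto simp: in_set_conv_nth)
      have "c y = 0" if y: "y \<in> E `` {v} - {b} - {as ! 0}" for y
      proof (rule c_out, rule notI)
        assume "y \<in> set as"
        then obtain i where i: "i < length as" "y = as ! i" by (metis in_set_conv_nth)
        have "v \<in> E `` {as ! i}" using y i symD by auto
        then have "v = (v # as) ! i" using nb_nth[OF i(1)] path_as(2) by (auto split: if_splits)
        then have "i = 0" using i path_as(2) by (cases i) auto
        then show False using i y by simp
      qed
      then have "nbsum E' c v = c (as ! 0)"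
        unfolding nb' using first finite_nb[of v] by (subst sum.remove[OF _ first]) auto
      also have "\<dots> = 1 / s (p + 1)" using c_as[of 0] p1 by (simp add: s_def)
      also have "\<dots> \<le> 1" using S by simp
      finally have "z b * nbsum E' c v \<le> z b" using zb0 by simp
      moreover have "nbsum E' z v = r * z v - z b"
        unfolding nb' using vb finite_nb[of v] z[OF v_in_V] by (simp add: sum_diff1)
      moreover have "c v = 0" using path_as by (intro c_out) auto
      ultimately show ?thesis unfolding nbw 1 by (simp add: w_def)
    next
      case 2
      have "c y = 0" if "(b, y) \<in> E" for y
        using as_nb_in[of y b] that b_notin by (intro c_out) auto
      then have "nbsum E' c b = c l"
        unfolding nb' using lb_notin finite_nb[of b] by simp
      moreover have "nbsum E' z b = r * z b - z v + z l"
        unfolding nb' using vb lb_notin finite_nb[of b] z[OF b_in_V] by (simp add: sum_diff1)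
      moreover have "c b = 0" using b_notin by (intro c_out)
      \<comment> \<open>At \<open>b\<close> the neighbour \<open>v\<close> is exchanged for
        \<open>l\<close>, so the new entry at \<open>l\<close> must not exceed \<open>z v\<close>.
        This is where the increment of at least 1 from \<open>s p\<close> to
        \<open>s (p + 1)\<close> enters.\<close>
      moreover have "z l + z b * c l \<le> z v"
      proof -
        have "z b * c l \<le> z v * c l" using zb c_nonneg by (intro mult_right_mono)
        also have "\<dots> = z l * s p" using zv cl S by simp
        finally have "z l + z b * c l \<le> z l * (s p + 1)" by (simp add: algebra_simps)
        also have "\<dots> \<le> z l * s (p + 1)" using zb0 growth(2)[of p] by simp
        finally show ?thesis using zv by (simp add: mult.commute)
      qed
      ultimately show ?thesis unfolding nbw 2 by (simp add: w_def)
    next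
      case 3
      then obtain i where i: "i < p" "x = as ! i" by (metis in_set_conv_nth p_def)
      have rec: "s i + s (Suc (Suc i)) = r * s (Suc i)" by (simp add: s_def)
      have rc: "r * c x = (s i + s (Suc (Suc i))) / s (p + 1)"
        unfolding i(2) c_as[OF i(1)] rec by simp
      show ?thesis
      proof (cases "Suc i < p")
        case True
        then have "x \<noteq> l"
          using i path_as(2) l_nth by (simp add: nth_eq_iff_index_eq p_def)
        then have E': "E' `` {x} = E `` {x}" using 3 b_notin path_as by (intro nb'(4)) auto
        have "(v # as) ! i \<noteq> (v # as) ! Suc (Suc i)"
          using path_as(2) True by (subst nth_eq_iff_index_eq) (auto simp: p_def)
        then have "nbsum E c x = c ((v # as) ! i) + c (as ! Suc i)"
          using nb_nth[of i] i True by (simp add: p_def)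
        also have "\<dots> = r * c x"
          using c_nth[of i] c_as[of "Suc i"] True rc by (simp add: add_divide_distrib)
        finally show ?thesis unfolding nbw E' z[OF x] by (simp add: w_def algebra_simps)
      next
        \<comment> \<open>At \<open>l\<close> the recurrence for \<open>c\<close> lacks its boundary
          value 1, contributing \<open>z b\<close>; the new neighbour \<open>b\<close> supplies
          exactly this, so equality holds.\<close>
        case False
        then have ip: "i = p - 1" "Suc i = p" using i by auto
        then have xl: "x = l" using i l_nth by (simp add: p_def)
        have "nbsum E c x = c ((v # as) ! i)" unfolding xl nb_l by (simp add: ip p_def)
        then have "nbsum E c x = s i / s (p + 1)" using c_nth[of i] i by simp
        moreover have "c b = 0" using b_notin by (intro c_out)
        ultimately have "nbsum E' c x = s i / s (p + 1)"
          unfolding xl nb' using lb_notin finite_nb[of l] by simp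
        moreover have "nbsum E' z x = z b + r * z x"
          using lb_notin finite_nb[of l] z[OF x] unfolding xl nb' by simp
        moreover have "r * c x = s i / s (p + 1) + 1"
          using rc ip S by (simp add: add_divide_distrib)
        moreover have "r * w x = r * z x + z b * (r * c x)" by (simp add: w_def algebra_simps)
        ultimately show ?thesis unfolding nbw by (simp add: distrib_left)
      qed
    next
      case 4
      then have E': "E' `` {x} = E `` {x}" using l_in by (intro nb'(4)) auto
      have "c y = 0" if "(x, y) \<in> E" for y
        using as_nb_in[of y x] that 4 by (intro c_out) auto
      then have "nbsum E c x = 0" by simp
      moreover have "c x = 0" using 4 by (intro c_out)
      ultimately show ?thesis unfolding nbw E' z[OF x] by (simp add: w_def)
    qed
  qed
  interpret E': connected_sgraph V E' by (rule connected_E')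
  show ?thesis
    unfolding r_def[symmetric]
  proof (rule E'.radius_le(1)[OF _ super])
    show "0 < w x" if "x \<in> V" for x
      unfolding w_def using pos[OF that] zb0 c_nonneg[of x] by (intro add_pos_nonneg) auto
  qed
qed

end

section \<open>Dissociation numbers and cycles\<close>

lemma pair_graph_iff_sgraph: "pair_graph G \<longleftrightarrow> sgraph (pverts G) (parcs G)"
proof
  assume "pair_graph G"
  then interpret pair_graph G .
  show "sgraph (pverts G) (parcs G)"
  proof unfold_locales
    show "finite (pverts G)" by (rule pair_finite_verts)
    show "parcs G \<subseteq> pverts G \<times> pverts G" using in_arcsD1 in_arcsD2 by auto
    show "sym (parcs G)" using arcs_symmetric by (auto intro: symI)
    show "irrefl (parcs G)" using pair_no_loops by (force simp: irrefl_def)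
  qed
next
  assume "sgraph (pverts G) (parcs G)"
  then interpret sgraph "pverts G" "parcs G" .
  show "pair_graph G"
  proof unfold_locales
    show "symmetric (with_proj G)" using sym_E by (simp add: symmetric_def)
  qed (use finite_V finite_E E_subset irrefl_E in \<open>auto simp: irrefl_def\<close>)
qed

text \<open>Connectedness of a digraph is strong connectedness of its symmetric closure, and a pair
  graph equals its symmetric closure.\<close>

lemma connected_iff_connected_sgraph:
  assumes "pair_graph G"
  shows "Digraph_Component.connected (with_proj G) \<longleftrightarrow> connected_sgraph (pverts G) (parcs G)"
proof -
  interpret pair_graph G by fact
  have sg: "sgraph (pverts G) (parcs G)" using assms pair_graph_iff_sgraph by blast
  have "parcs (mk_symmetric (with_proj G)) = parcs G"
    using arcs_symmetric by (force simp: parcs_mk_symmetric)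
  then have "mk_symmetric (with_proj G) = G"
    by (intro pair_pre_digraph.equality) simp_all
  moreover have "reachable (with_proj G) u v \<longleftrightarrow> (u, v) \<in> (parcs G)\<^sup>*" if "u \<in> pverts G" for u v
    using that by (simp add: reachable_conv')
  ultimately show ?thesis
    using sg unfolding Digraph_Component.connected_def strongly_connected_def
      connected_sgraph_def connected_sgraph_axioms_def by auto
qed

lemma mem_graphs_with_diss_iff:
  "G \<in> graphs_with_diss n k \<longleftrightarrow>
     connected_sgraph (pverts G) (parcs G) \<and> card (pverts G) = n \<and> diss G = k"
  using connected_iff_connected_sgraph[of G] pair_graph_iff_sgraph[of G]
    connected_sgraph.axioms(1)[of "pverts G" "parcs G"]
  by (auto simp: graphs_with_diss_def)

lemma dissociation_set_iff:
  "dissociation_set \<lparr>pverts = V, parcs = E\<rparr> S \<longleftrightarrow> S \<subseteq> V \<and> (\<forall>v\<in>S. card (E `` {v} \<inter> S) \<le> 1)"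
proof -
  have "out_degree (with_proj \<lparr>pverts = V, parcs = E\<rparr> \<restriction> S) v = card (E `` {v} \<inter> S)"
    if "v \<in> S" for v
  proof -
    have "out_arcs (with_proj \<lparr>pverts = V, parcs = E\<rparr> \<restriction> S) v = Pair v ` (E `` {v} \<inter> S)"
      using that by (auto simp: out_arcs_def)
    then show ?thesis by (simp add: out_degree_def card_image inj_on_def)
  qed
  then show ?thesis by (auto simp: dissociation_set_def)
qed

section \<open>Dissociation numbers under changes of the edges\<close>

abbreviation diss_number :: "'a set \<Rightarrow> 'a rel \<Rightarrow> nat" where
  "diss_number V E \<equiv> diss \<lparr>pverts = V, parcs = E\<rparr>"

lemma finite_dissociation_sizes:
  assumes "finite V"
  shows "finite {card S | S. dissociation_set \<lparr>pverts = V, parcs = E\<rparr> S}"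
proof -
  have "{card S | S. dissociation_set \<lparr>pverts = V, parcs = E\<rparr> S} \<subseteq> card ` Pow V"
    by (auto simp: dissociation_set_iff)
  then show ?thesis using assms finite_subset by blast
qed

lemma card_le_diss:
  "finite V \<Longrightarrow> dissociation_set \<lparr>pverts = V, parcs = E\<rparr> S \<Longrightarrow> card S \<le> diss_number V E"
  unfolding diss_def by (rule Max_ge[OF finite_dissociation_sizes]) auto

lemma diss_attained:
  assumes "finite V"
  obtains S where "dissociation_set \<lparr>pverts = V, parcs = E\<rparr> S" "card S = diss_number V E"
proof -
  have "dissociation_set \<lparr>pverts = V, parcs = E\<rparr> {}" by (simp add: dissociation_set_iff)
  then have "{card S | S. dissociation_set \<lparr>pverts = V, parcs = E\<rparr> S} \<noteq> {}" by blast
  with assms have "diss_number V E \<in> {card S | S. dissociation_set \<lparr>pverts = V, parcs = E\<rparr> S}"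
    unfolding diss_def by (intro Max_in finite_dissociation_sizes)
  then show thesis using that by auto
qed

text \<open>Arcs are compared only inside \<open>S'\<close>, so this covers both the deletion of
  edges and rehanging, where \<open>S'\<close> omits an end of the new edge.\<close>

lemma dissociation_set_if_fewer_arcs:
  assumes "finite V" "dissociation_set \<lparr>pverts = V, parcs = E\<rparr> S" "S' \<subseteq> S"
    and arcs: "\<And>x y. (x, y) \<in> E' \<Longrightarrow> x \<in> S' \<Longrightarrow> y \<in> S' \<Longrightarrow> (x, y) \<in> E"
  shows "dissociation_set \<lparr>pverts = V, parcs = E'\<rparr> S'"
  unfolding dissociation_set_iff
proof (intro conjI ballI)
  have S: "S \<subseteq> V" "\<And>v. v \<in> S \<Longrightarrow> card (E `` {v} \<inter> S) \<le> 1"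
    using assms(2) by (auto simp: dissociation_set_iff)
  show "S' \<subseteq> V" using assms(3) S(1) by (rule subset_trans)
  fix v assume v: "v \<in> S'"
  have "finite S" using S(1) assms(1) by (rule finite_subset)
  then have "card (E' `` {v} \<inter> S') \<le> card (E `` {v} \<inter> S)"
    using v assms(3) arcs by (intro card_mono) auto
  also have "\<dots> \<le> 1" by (rule S(2)) (use v assms(3) in blast)
  finally show "card (E' `` {v} \<inter> S') \<le> 1" .
qed

lemma diss_antimono:
  assumes "finite V" "E' \<subseteq> E"
  shows "diss_number V E \<le> diss_number V E'"
proof -
  obtain S where S: "dissociation_set \<lparr>pverts = V, parcs = E\<rparr> S" "card S = diss_number V E"
    using assms(1) by (rule diss_attained)
  have "dissociation_set \<lparr>pverts = V, parcs = E'\<rparr> S"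
    by (rule dissociation_set_if_fewer_arcs[OF assms(1) S(1)]) (use assms(2) in auto)
  then show ?thesis using card_le_diss[OF assms(1), of E' S] S(2) by simp
qed

text \<open>Removing \<open>b\<close> from a maximum dissociation set avoids the only new edge and
  costs at most one vertex.\<close>

lemma (in rehang) diss_E': "diss_number V E \<le> diss_number V E' + 1"
proof -
  obtain S where S: "dissociation_set \<lparr>pverts = V, parcs = E\<rparr> S" "card S = diss_number V E"
    using finite_V by (rule diss_attained)
  have "dissociation_set \<lparr>pverts = V, parcs = E'\<rparr> (S - {b})"
    by (rule dissociation_set_if_fewer_arcs[OF finite_V S(1)]) (auto simp: E'_def)
  then have "card (S - {b}) \<le> diss_number V E'" by (rule card_le_diss[OF finite_V])
  moreover have "card S \<le> card (S - {b}) + 1"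
    by (simp add: card_Diff_singleton_if) arith
  ultimately show ?thesis using S by simp
qed

text \<open>
  A cycle of length at least 3 yields a walk between the ends of its first edge that avoids this
  edge in both directions, so this edge can be deleted without disconnecting the graph; a tree has
  too few edges for that.
\<close>

lemma pcas_imp_rtrancl: "pcas u p v \<Longrightarrow> set p \<subseteq> R \<Longrightarrow> (u, v) \<in> R\<^sup>*"
  by (induction p arbitrary: u) (auto intro: converse_rtrancl_into_rtrancl)

lemma pcas_last: "pcas u p v \<Longrightarrow> last (pawalk_verts u p) = v"
proof (induction p arbitrary: u)
  case (Cons e p)
  then show ?case by (cases p) auto
qed simp

text \<open>An arc starting at the final vertex would make that vertex occur twice on the
  walk.\<close>

lemma pcas_distinct_tail_ne:
  "pcas u p v \<Longrightarrow> distinct (pawalk_verts u p) \<Longrightarrow> e \<in> set p \<Longrightarrow> fst e \<noteq> v"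
proof (induction p arbitrary: u)
  case (Cons a p)
  have "v \<in> set (pawalk_verts (snd a) p)"
    using Cons.prems(1) pcas_last[of "snd a" p v] last_in_set[of "pawalk_verts (snd a) p"]
    by (cases p) auto
  then show ?case using Cons by auto
qed simp

lemma sym_tree_no_cycle:
  assumes tree: "sym_tree V E"
    and cycle: "pre_digraph.cycle (with_proj \<lparr>pverts = V, parcs = E\<rparr>) p" "3 \<le> length p"
  shows False
proof -
  interpret connected_sgraph V E using sym_tree_connected tree .
  obtain u where u: "set p \<subseteq> E" "pcas u p u" "distinct (tl (pawalk_verts u p))"
    using cycle(1)
    by (auto simp: pre_digraph.cycle_def pre_digraph.awalk_def cas_with_proj_eq awalk_verts_with_proj_eq)
  obtain e q where p: "p = e # q" using cycle(2) by (cases p) auto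
  obtain x where e: "e = (u, x)" using u(2) p by (cases e) auto
  have q: "pcas x q u" "distinct (pawalk_verts x q)" "set q \<subseteq> E" and uxE: "(u, x) \<in> E"
    using u p e by auto
  have ux: "u \<noteq> x" using uxE irrefl_E by (auto simp: irrefl_def)
  have not_ux: "(u, x) \<notin> set q" using pcas_distinct_tail_ne[OF q(1,2)] by fastforce
  \<comment> \<open>The vertex \<open>x\<close> occurs only at the start of \<open>q\<close>, so the
    reversed arc would be the first arc of \<open>q\<close>. Length at least 3 provides a next arc,
    which would start at \<open>u\<close>, the final vertex of \<open>q\<close>.\<close>
  have not_xu: "(x, u) \<notin> set q"
  proof
    assume xu: "(x, u) \<in> set q"
    obtain f q' where q': "q = f # q'" using cycle(2) p by (cases q) auto
    have fst_in: "fst g \<in> set (pawalk_verts y r)" if "g \<in> set r" for g y and r :: "('a \<times> 'a) list"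
      using that by (induction r arbitrary: y) auto
    have "x \<notin> set (pawalk_verts (snd f) q')" using q q' by auto
    then have "f = (x, u)" using xu q' fst_in[of "(x, u)" q' "snd f"] by auto
    moreover obtain g q'' where "q' = g # q''" using cycle(2) p q' by (cases q') auto
    ultimately have "fst g = u" "g \<in> set q" using q(1) q' by auto
    then show False using pcas_distinct_tail_ne[OF q(1,2)] by blast
  qed
  define R where "R = E - {(u, x), (x, u)}"
  have "(x, u) \<in> R\<^sup>*"
    using q not_ux not_xu by (intro pcas_imp_rtrancl[of x q]) (auto simp: R_def)
  moreover have symR: "sym R" using symD by (auto simp: R_def sym_def)
  then have "(u, x) \<in> R\<^sup>*" using \<open>(x, u) \<in> R\<^sup>*\<close> by (metis sym_rtrancl Relation.symD)
  ultimately have "E \<subseteq> R\<^sup>*" by (auto simp: R_def)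
  then have "E\<^sup>* \<subseteq> R\<^sup>*" by (rule rtrancl_subset_rtrancl)
  moreover have "irrefl R" "R \<subseteq> V \<times> V" using irrefl_E E_subset by (auto simp: R_def irrefl_def)
  ultimately have "connected_sgraph V R"
    using symR finite_V nonempty connected by unfold_locales auto
  then have "2 * card V \<le> card R + 2" by (rule connected_sgraph.card_arcs_ge)
  moreover have "card R < card E"
    using uxE finite_E by (intro psubset_card_mono) (auto simp: R_def)
  ultimately show False using sym_tree_card[OF tree] by simp
qed

lemma is_tree_if_sym_tree:
  assumes "sym_tree (pverts G) (parcs G)"
  shows "is_tree G"
proof -
  have c: "connected_sgraph (pverts G) (parcs G)" using assms by (rule sym_tree_connected)
  then have pg: "pair_graph G" by (simp add: pair_graph_iff_sgraph connected_sgraph.axioms(1))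
  then have "Digraph_Component.connected (with_proj G)" using c connected_iff_connected_sgraph by blast
  moreover have "\<not> (\<exists>p. pre_digraph.cycle (with_proj G) p \<and> length p \<ge> 3)"
  proof -
    have "\<lparr>pverts = pverts G, parcs = parcs G\<rparr> = G"
      by (rule pair_pre_digraph.equality) simp_all
    from sym_tree_no_cycle[OF assms, unfolded this] show ?thesis by auto
  qed
  ultimately show ?thesis using pg by (simp add: is_tree_def)
qed

text \<open>
  Each rehanging step lowers the dissociation number by at most one, so that number takes the
  value \<open>k\<close> before the number of leaves drops below 4.
\<close>

lemma tree_with_smaller_diss:
  assumes "connected_sgraph V T" "card T + 2 = 2 * card V"
    and "k \<le> diss_number V T" "2 * card V + 3 \<le> 3 * k"
  shows "\<exists>H. connected_sgraph V H \<and> diss_number V H = k \<and> radius V H \<le> radius V T"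
  using assms
proof (induction "card (leaves V T)" arbitrary: T rule: less_induct)
  case less
  interpret connected_sgraph V T by (rule less.prems)
  show ?case
  proof (cases "diss_number V T = k")
    case True
    then show ?thesis using less.prems(1) by blast
  next
    case False
    then have k: "k + 1 \<le> diss_number V T" using less.prems by simp
    obtain S where S: "dissociation_set \<lparr>pverts = V, parcs = T\<rparr> S" "card S = diss_number V T"
      using finite_V by (rule diss_attained)
    have SV: "S \<subseteq> V" "\<And>v. v \<in> S \<Longrightarrow> card (T `` {v} \<inter> S) \<le> 1"
      using S(1) by (auto simp: dissociation_set_iff)
    have "card S \<le> card V" using SV(1) finite_V by (intro card_mono)
    then have V2: "3 \<le> card V" using S(2) k less.prems(4) by linarith
    have "3 * card S + 2 \<le> 2 * card V + 2 * card (leaves V T)"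
      using less.prems(2) V2 SV by (intro tree_dissociation_bound) auto
    \<comment> \<open>From \<open>card S \<ge> k + 1\<close> and
      \<open>3 * k \<ge> 2 * card V + 3\<close> the left side is at least
      \<open>2 * card V + 8\<close>.\<close>
    then have L: "4 \<le> card (leaves V T)" using S(2) k less.prems(4) by linarith
    obtain v as bs where p: "two_pendant_paths T v as bs"
      using sym_tree_two_pendant_paths[OF sym_tree_if_card[OF less.prems(2)] V2] by blast
    interpret rehang V T v as bs
      using p L by unfold_locales (auto intro: card_nb_branch_vertex)
    have "2 \<le> radius V T" using less.prems(2) L by (rule radius_ge_2)
    then have r: "radius V E' \<le> radius V T" by (rule radius_E')
    have "k \<le> diss_number V E'" using diss_E' k by simp
    then obtain H where "connected_sgraph V H" "diss_number V H = k" "radius V H \<le> radius V E'"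
      using less.hyps[OF card_leaves_E' connected_E'] card_E' less.prems(2,4) by auto
    then show ?thesis using r by (intro exI[of _ H]) simp
  qed
qed

theorem theorem1p1:
  fixes n k :: nat and G :: "'a pair_pre_digraph"
  assumes "n > 0" and "k > 0"
    and "int k > \<lceil>2 * real n / 3\<rceil>"
    and "G \<in> graphs_with_diss n k"
    and "\<forall>H \<in> (graphs_with_diss n k :: 'a pair_pre_digraph set). rho G \<le> rho H"
  shows "is_tree G"
proof -
  obtain V E where G: "G = \<lparr>pverts = V, parcs = E\<rparr>"
    by (cases G)
  have conn: "connected_sgraph V E" and n: "card V = n" and k: "diss G = k"
    using assms(4) by (simp_all add: mem_graphs_with_diss_iff G)
  interpret connected_sgraph V E by (rule conn)
  obtain T where T: "T \<subseteq> E" "sym_tree V T" using spanning_tree by blast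
  have "T = E"
  proof (rule ccontr)
    assume "T \<noteq> E"
    have cT: "connected_sgraph V T" using T(2) by (rule sym_tree_connected)
    have less: "radius V T < radius V E"
      using T(1) \<open>T \<noteq> E\<close> by (intro radius_spanning_less cT) auto
    \<comment> \<open>Integrality turns the strict inequality into a gap of 1, which becomes the
      summand 3 after multiplying by 3.\<close>
    have "\<lceil>2 * real n / 3\<rceil> + 1 \<le> int k" using assms(3) by simp
    moreover have "2 * real n / 3 \<le> of_int \<lceil>2 * real n / 3\<rceil>" by (rule le_of_int_ceiling)
    ultimately have "2 * real n / 3 + 1 \<le> real k" by linarith
    then have "2 * card V + 3 \<le> 3 * k" using n by linarith
    moreover have "k \<le> diss_number V T" using diss_antimono[OF finite_V T(1)] k G by simp
    ultimately obtain H where H: "connected_sgraph V H" "diss_number V H = k"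
      "radius V H \<le> radius V T"
      using tree_with_smaller_diss[OF cT sym_tree_card[OF T(2)]] by blast
    then have "\<lparr>pverts = V, parcs = H\<rparr> \<in> graphs_with_diss n k"
      using n by (simp add: mem_graphs_with_diss_iff)
    then have "radius V E \<le> radius V H" using assms(5) unfolding G by blast
    then show False using less H(3) by simp
  qed
  then have "sym_tree (pverts G) (parcs G)" using T(2) by (simp add: G)
  then show ?thesis by (rule is_tree_if_sym_tree)
qed

end
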